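(* The Banach space $c_0(\omega_0,\mathbf{K})$ over the uniformly complete non-Archimedean normed infinite field $\mathbf{K}$, supplied with its norm topology, is homeomorphic (as a topological space) to the countable product $\mathbf{K}^{\omega_0}$ supplied with the Tychonoff product topology.
   Context: Standing assumptions on $\mathbf{K}$: $\mathbf{K}$ is an infinite field with a multiplicative norm $|\cdot|$ ($|xy|=|x||y|$, $|x|=0$ iff $x=0$) satisfying $|x+y|\le\max(|x|,|y|)$. The norm takes values in $[0,\infty)\subset\mathbb{R}$ or, more generally, in the non-negative elements of a linearly ordered commutative topological ring $\mathcal{R}$ that is complete as a uniform space and in which $p^{-n}\to 0$ as $n\to\infty$ for invertible $p>1$; norms of nonzero elements are invertible in $\mathcal{R}$. The group $\Gamma_{\mathbf{K}}=\{|x|: x\in\mathbf{K}, x\ne 0\}$ is infinite, its closure in $\mathcal{R}$ contains $0$, and there is $x\in\mathbf{K}$ with $|x|>1$. $\mathbf{K}$ is complete as a uniform space, locally compact, and $\Gamma_{\mathbf{K}}$ is discrete. $\omega_0$ is the first countable ordinal (index set identified with $\mathbb{N}=\{1,2,3,\dots\}$). $c_0(\omega_0,\mathbf{K})$ is the space of all $x=(x_j)_{j\in\omega_0}$, $x_j\in\mathbf{K}$, such that for each $\epsilon>0$ the set $\{j: |x_j|>\epsilon\}$ is finite, with norm $\|x\|=\sup_j|x_j|$. *)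

theory Defs
  imports "HOL-Analysis.Analysis"
begin

text \<open>
  The norm takes values in a linearly ordered commutative topological ring \<open>'r\<close> carrying its
  order topology.  The sort \<open>linordered_ring\<close> does not exclude zero divisors.  For an abelian
  topological group the class \<open>uniform_topological_group_add\<close> forces the uniformity to be the
  additive one, so \<open>complete_uniform_space\<close> is completeness of \<open>'r\<close> as a topological ring.
  The type \<open>real\<close> has this sort.

  The topology and uniformity of the field \<open>'k\<close> are pinned to those of the norm by the
  assumption \<open>uniformity_norm\<close>; openness then follows from the class \<open>uniform_space\<close>.
\<close>

locale nonarch_norm =
  fixes nrm :: "'k::{field, uniform_space} \<Rightarrow>
    'r::{linordered_ring, comm_ring_1, linorder_topology, topological_semigroup_mult,
         uniform_topological_group_add, complete_uniform_space}"
  assumes norm_nonneg: "0 \<le> nrm x"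
    and norm_eq_0_iff: "nrm x = 0 \<longleftrightarrow> x = 0"
    and norm_mult: "nrm (x * y) = nrm x * nrm y"
    and norm_add: "nrm (x + y) \<le> max (nrm x) (nrm y)"
    and norm_unit: "x \<noteq> 0 \<Longrightarrow> nrm x dvd 1"
    and uniformity_norm:
      "(uniformity :: ('k \<times> 'k) filter) =
         (INF e\<in>{0<..}. principal {(x, y). nrm (x - y) < e})"

definition value_group :: "('k::field \<Rightarrow> 'r) \<Rightarrow> 'r set" where
  "value_group nrm = nrm ` {x. x \<noteq> 0}"

definition c0 :: "('k::field \<Rightarrow> 'r::linordered_ring) \<Rightarrow> (nat \<Rightarrow> 'k) set" where
  "c0 nrm = {x. \<forall>e>0. finite {j. nrm (x j) > e}}"

text \<open>
  The supremum is written as the least upper bound because \<open>'r\<close> need not be conditionally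
  complete; on \<open>c0\<close> it exists and is attained (see \<open>c0_norm_attained\<close> below).
\<close>

definition c0_norm :: "('k::field \<Rightarrow> 'r::linordered_ring) \<Rightarrow> (nat \<Rightarrow> 'k) \<Rightarrow> 'r" where
  "c0_norm nrm x = (LEAST r. \<forall>j. nrm (x j) \<le> r)"

definition c0_topology ::
  "('k::field \<Rightarrow> 'r::linordered_ring) \<Rightarrow> (nat \<Rightarrow> 'k) topology" where
  "c0_topology nrm = topology (\<lambda>U. U \<subseteq> c0 nrm \<and>
     (\<forall>x\<in>U. \<exists>e>0. \<forall>y\<in>c0 nrm. c0_norm nrm (\<lambda>j. y j - x j) < e \<longrightarrow> y \<in> U))"

lemma openin_c0_topology:
  fixes nrm :: "'k::field \<Rightarrow> 'r::linordered_ring"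
  shows "openin (c0_topology nrm) U \<longleftrightarrow> U \<subseteq> c0 nrm \<and>
     (\<forall>x\<in>U. \<exists>e>0. \<forall>y\<in>c0 nrm. c0_norm nrm (\<lambda>j. y j - x j) < e \<longrightarrow> y \<in> U)"
proof -
  define P where "P = (\<lambda>U. U \<subseteq> c0 nrm \<and>
     (\<forall>x\<in>U. \<exists>e>0. \<forall>y\<in>c0 nrm. c0_norm nrm (\<lambda>j. y j - x j) < e \<longrightarrow> y \<in> U))"
  have "P (S \<inter> T)" if S: "P S" and T: "P T" for S T
    unfolding P_def
  proof (intro conjI ballI)
    show "S \<inter> T \<subseteq> c0 nrm" using S unfolding P_def by blast
  next
    fix x assume x: "x \<in> S \<inter> T"
    then obtain d where d: "d > 0"
      "\<forall>y\<in>c0 nrm. c0_norm nrm (\<lambda>j. y j - x j) < d \<longrightarrow> y \<in> S" using S unfolding P_def by blast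
    from x obtain e where e: "e > 0"
      "\<forall>y\<in>c0 nrm. c0_norm nrm (\<lambda>j. y j - x j) < e \<longrightarrow> y \<in> T" using T unfolding P_def by blast
    show "\<exists>e>0. \<forall>y\<in>c0 nrm. c0_norm nrm (\<lambda>j. y j - x j) < e \<longrightarrow> y \<in> S \<inter> T"
      using d e by (intro exI[of _ "min d e"]) auto
  qed
  moreover have "P (\<Union>\<K>)" if \<K>: "\<forall>K\<in>\<K>. P K" for \<K>
    unfolding P_def
  proof (intro conjI ballI)
    show "\<Union>\<K> \<subseteq> c0 nrm" using \<K> unfolding P_def by blast
  next
    fix x assume "x \<in> \<Union>\<K>"
    then obtain K where K: "K \<in> \<K>" "x \<in> K" by blast
    with \<K> obtain e where "e > 0"
      "\<forall>y\<in>c0 nrm. c0_norm nrm (\<lambda>j. y j - x j) < e \<longrightarrow> y \<in> K" unfolding P_def by blast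
    with K show "\<exists>e>0. \<forall>y\<in>c0 nrm. c0_norm nrm (\<lambda>j. y j - x j) < e \<longrightarrow> y \<in> \<Union>\<K>"
      by blast
  qed
  ultimately have "istopology P"
    unfolding istopology_def by blast
  then show ?thesis
    unfolding c0_topology_def P_def by simp
qed

context nonarch_norm
begin

lemma c0_norm_attained:
  assumes x: "x \<in> c0 nrm"
  obtains j where "c0_norm nrm x = nrm (x j)" "\<And>i. nrm (x i) \<le> nrm (x j)"
proof -
  have "\<exists>j. \<forall>i. nrm (x i) \<le> nrm (x j)"
  proof (cases "\<forall>i. x i = 0")
    case True
    then show ?thesis by simp
  next
    case False
    then obtain k where k: "x k \<noteq> 0" by blast
    then have pos: "nrm (x k) > 0"
      using norm_nonneg[of "x k"] norm_eq_0_iff[of "x k"] by (simp add: order_less_le)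
    let ?A = "insert k {j. nrm (x j) > nrm (x k)}"
    have "finite {j. nrm (x j) > nrm (x k)}"
      using x pos by (simp add: c0_def)
    then have fin: "finite ((\<lambda>j. nrm (x j)) ` ?A)" by simp
    obtain j where j: "Max ((\<lambda>j. nrm (x j)) ` ?A) = nrm (x j)"
      using Max_in[OF fin] by blast
    have le: "nrm (x i) \<le> nrm (x j)" if "i \<in> ?A" for i
      using Max_ge[OF fin] that j by (metis imageI)
    have "nrm (x i) \<le> nrm (x j)" for i
    proof (cases "i \<in> ?A")
      case False
      then have "nrm (x i) \<le> nrm (x k)" by auto
      also have "\<dots> \<le> nrm (x j)" by (rule le) simp
      finally show ?thesis .
    qed (rule le)
    then show ?thesis by blast
  qed
  then obtain j where j: "\<And>i. nrm (x i) \<le> nrm (x j)" by blast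
  have "c0_norm nrm x = nrm (x j)"
    unfolding c0_norm_def by (rule Least_equality) (use j in auto)
  with j show thesis using that by blast
qed

lemma topspace_c0_topology: "topspace (c0_topology nrm) = c0 nrm"
proof (rule antisym)
  show "topspace (c0_topology nrm) \<subseteq> c0 nrm"
    unfolding topspace_def by (simp add: openin_c0_topology Sup_le_iff)
  have "nrm 1 > 0"
    using norm_nonneg[of 1] norm_eq_0_iff[of 1] by (simp add: order_less_le)
  then have "openin (c0_topology nrm) (c0 nrm)"
    unfolding openin_c0_topology by blast
  then show "c0 nrm \<subseteq> topspace (c0_topology nrm)"
    by (rule openin_subset)
qed

end

end

theory Submission
  imports Defs
begin

text \<open>
  Both spaces are copies of the Baire space \<open>nat \<Rightarrow> nat\<close>.  Each carries a decreasing sequence of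
  equivalence relations, with a single class at stage \<open>0\<close>, whose classes form a base of the topology,
  and every class of one stage splits into countably infinitely many classes of the next.  Numbering
  the subclasses of every class turns a point into the sequence of numbers chosen along its chain of
  classes.  This coding is injective because the relations separate points, surjective because nested
  classes have a common point (completeness), and two points lie in one class of stage \<open>n\<close> exactly
  when their codes agree below \<open>n\<close> (\<open>bij_betw_code\<close>, \<open>E_iff_code_prefix\<close>).  Hence matching the points
  with equal codes carries classes to classes and is a homeomorphism
  (\<open>homeomorphic_baire_filtrations\<close>).

  For the two sequence spaces, fix a scalar \<open>\<pi>\<close> with \<open>0 < nrm \<pi> < 1\<close> and powers tending to \<open>0\<close>, and
  call scalars near at stage \<open>n\<close> if their distance is at most \<open>nrm (\<pi> ^ n)\<close>.  In \<open>c\<^sub>0\<close>, relate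
  sequences near at stage \<open>n\<close> in every coordinate; in the product, relate sequences near at stage \<open>n\<close>
  in the coordinates below \<open>n\<close>.  The splitting is infinite for two different reasons: in \<open>c\<^sub>0\<close> there are
  infinitely many coordinates in which to move by \<open>\<pi> ^ n\<close>, while in the product stage \<open>Suc n\<close> newly
  constrains the coordinate \<open>n\<close>, whose values \<open>1 / \<pi> ^ Suc m\<close> are pairwise far apart.  It is
  countable because the field is separable (\<open>countable_near_dense\<close>): a compact neighbourhood of \<open>0\<close> is
  totally bounded, and scaling by powers of \<open>\<pi>\<close> spreads its finite nets over the whole field.
\<close>

section \<open>Spaces filtered by infinitely branching equivalence relations\<close>

text \<open>
  \<open>E n x y\<close> says that \<open>x\<close> and \<open>y\<close> cannot be distinguished at stage \<open>n\<close>.  The classes within \<open>X\<close> form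
  a tree whose root is \<open>X\<close> itself (by \<open>E_0\<close>); \<open>chain_limit\<close> says that every infinite branch has a
  point, and \<open>countable_dense\<close> and \<open>branching\<close> together say that every node has countably infinitely
  many children.
\<close>

locale baire_filtration =
  fixes X :: "'a set" and E :: "nat \<Rightarrow> 'a \<Rightarrow> 'a \<Rightarrow> bool"
  assumes equiv: "equivp (E n)"
    and E_0: "E 0 x y"
    and E_Suc: "E (Suc n) x y \<Longrightarrow> E n x y"
    and separated: "(\<And>n. E n x y) \<Longrightarrow> x = y"
    and nonempty: "X \<noteq> {}"
    and chain_limit: "(\<And>n. s n \<in> X) \<Longrightarrow> (\<And>n. E n (s n) (s (Suc n))) \<Longrightarrow>
        \<exists>y\<in>X. \<forall>n. E n (s n) y"
    and countable_dense: "\<exists>D\<subseteq>X. countable D \<and> (\<forall>n. \<forall>x\<in>X. \<exists>d\<in>D. E n x d)"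
    and branching: "x \<in> X \<Longrightarrow> \<exists>t :: nat \<Rightarrow> 'a. \<forall>m. t m \<in> X \<and> E n x (t m) \<and>
        (\<forall>l. l \<noteq> m \<longrightarrow> \<not> E (Suc n) (t m) (t l))"
begin

lemma E_refl: "E n x x" and E_sym: "E n x y \<Longrightarrow> E n y x"
  and E_trans: "E n x y \<Longrightarrow> E n y z \<Longrightarrow> E n x z"
  using equiv[of n] equivp_reflp equivp_symp equivp_transp by metis+

definition cls :: "nat \<Rightarrow> 'a \<Rightarrow> 'a set" where
  "cls n x = {y\<in>X. E n x y}"

definition children :: "nat \<Rightarrow> 'a \<Rightarrow> 'a set set" where
  "children n x = cls (Suc n) ` cls n x"

text \<open>
  The numbering belongs to the set of children and not to the point \<open>x\<close>, so points in the same class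
  at stage \<open>n\<close> number their children in the same way.
\<close>

definition code :: "'a \<Rightarrow> nat \<Rightarrow> nat" where
  "code x n = to_nat_on (children n x) (cls (Suc n) x)"

lemma cls_eq_iff: "x \<in> X \<Longrightarrow> y \<in> X \<Longrightarrow> cls n x = cls n y \<longleftrightarrow> E n x y"
  unfolding cls_def using E_refl E_sym E_trans by blast

lemma cls_in_children: "x \<in> X \<Longrightarrow> y \<in> X \<Longrightarrow> E n x y \<Longrightarrow> cls (Suc n) y \<in> children n x"
  unfolding children_def cls_def by blast

lemma children_cong: "x \<in> X \<Longrightarrow> y \<in> X \<Longrightarrow> E n x y \<Longrightarrow> children n x = children n y"
  unfolding children_def using cls_eq_iff by metis

text \<open>
  A countable dense set meets every child, and \<open>branching\<close> exhibits an infinite family of distinct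
  children, so the chosen numbering uses every natural number exactly once.
\<close>

lemma bij_betw_children:
  assumes x: "x \<in> X"
  shows "bij_betw (to_nat_on (children n x)) (children n x) UNIV"
proof (rule to_nat_on_infinite)
  obtain D where D: "D \<subseteq> X" "countable D" "\<And>y. y \<in> X \<Longrightarrow> \<exists>d\<in>D. E (Suc n) y d"
    using countable_dense by blast
  have "children n x \<subseteq> cls (Suc n) ` D"
  proof
    fix c assume "c \<in> children n x"
    then obtain y where y: "y \<in> X" "c = cls (Suc n) y"
      unfolding children_def by (auto simp: cls_def)
    with D(3) obtain d where "d \<in> D" "E (Suc n) y d" by blast
    with y D(1) show "c \<in> cls (Suc n) ` D"
      using cls_eq_iff by blast
  qed
  with D(2) show "countable (children n x)"
    using countable_image countable_subset by blast
  obtain t :: "nat \<Rightarrow> 'a" where t: "\<And>m. t m \<in> X" "\<And>m. E n x (t m)"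
      "\<And>m l. l \<noteq> m \<Longrightarrow> \<not> E (Suc n) (t m) (t l)"
    using branching[OF x] by metis
  have "inj (\<lambda>m. cls (Suc n) (t m))"
    using t cls_eq_iff by (intro injI) metis
  moreover have "range (\<lambda>m. cls (Suc n) (t m)) \<subseteq> children n x"
    using t x cls_in_children by blast
  ultimately show "infinite (children n x)"
    using infinite_super range_inj_infinite by blast
qed

text \<open>
  Once two points share a class at stage \<open>n\<close>, they choose from the same injectively numbered children,
  so their next code entries agree exactly when the next classes do.
\<close>

lemma E_iff_code_prefix:
  assumes x: "x \<in> X" and y: "y \<in> X"
  shows "E n x y \<longleftrightarrow> (\<forall>i<n. code x i = code y i)"
proof (induction n)
  case 0
  show ?case using E_0 by simp
next
  case (Suc n)
  have "E (Suc n) x y \<longleftrightarrow> code x n = code y n" if "E n x y"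
  proof -
    have ch: "children n x = children n y"
      using children_cong x y that by blast
    have "inj_on (to_nat_on (children n x)) (children n x)"
      using bij_betw_children[OF x] bij_betw_def by blast
    moreover have "cls (Suc n) x \<in> children n x" "cls (Suc n) y \<in> children n x"
      using cls_in_children x y that E_refl by blast+
    ultimately show ?thesis
      unfolding code_def ch[symmetric] using cls_eq_iff[OF x y] inj_on_eq_iff by metis
  qed
  then show ?case
    using Suc E_Suc less_Suc_eq by metis
qed

text \<open>
  Surjectivity descends the tree along the child numbers prescribed by \<open>s\<close>; the point on the
  resulting branch has code \<open>s\<close>.
\<close>

lemma bij_betw_code: "bij_betw code X UNIV"
  unfolding bij_betw_def
proof (intro conjI inj_onI equalityI subset_UNIV subsetI)
  fix x y assume "x \<in> X" "y \<in> X" "code x = code y"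
  then show "x = y"
    using E_iff_code_prefix separated by metis
next
  fix s :: "nat \<Rightarrow> nat"
  have "\<exists>f. \<forall>n. f n \<in> X \<and> (E n (f n) (f (Suc n)) \<and> code (f (Suc n)) n = s n)"
  proof (rule dependent_nat_choice)
    show "\<exists>x. x \<in> X" using nonempty by blast
  next
    fix x n assume x: "x \<in> X"
    from bij_betw_children[OF x]
    obtain c where c: "c \<in> children n x" "to_nat_on (children n x) c = s n"
      unfolding bij_betw_def by (metis UNIV_I imageE)
    then obtain y where "y \<in> X" "E n x y" "c = cls (Suc n) y"
      unfolding children_def by (auto simp: cls_def)
    with x c show "\<exists>y. y \<in> X \<and> E n x y \<and> code y n = s n"
      using children_cong unfolding code_def by metis
  qed
  then obtain f where f: "\<And>n. f n \<in> X" "\<And>n. E n (f n) (f (Suc n))"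
      "\<And>n. code (f (Suc n)) n = s n"
    by blast
  then obtain y where y: "y \<in> X" "\<And>n. E n (f n) y"
    using chain_limit by blast
  have "code y n = s n" for n
    using E_iff_code_prefix[OF f(1)[of "Suc n"] y(1), of "Suc n"] y(2)[of "Suc n"] f(3)[of n]
    by (metis lessI)
  then have "s = code y" by auto
  then show "s \<in> code ` X" using y(1) by blast
qed

end

text \<open>The classes within \<open>X\<close> are a neighbourhood base for \<open>T\<close>.\<close>

definition filtration_topology :: "'a topology \<Rightarrow> 'a set \<Rightarrow> (nat \<Rightarrow> 'a \<Rightarrow> 'a \<Rightarrow> bool) \<Rightarrow> bool" where
  "filtration_topology T X E \<longleftrightarrow> topspace T = X \<and>
    (\<forall>U. openin T U \<longleftrightarrow> U \<subseteq> X \<and> (\<forall>x\<in>U. \<exists>n. \<forall>y\<in>X. E n x y \<longrightarrow> y \<in> U))"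

lemma continuous_map_filtration_topology:
  assumes S: "filtration_topology S X E" and T: "filtration_topology T Y F"
    and f: "\<And>x. x \<in> X \<Longrightarrow> f x \<in> Y"
    and EF: "\<And>n x y. x \<in> X \<Longrightarrow> y \<in> X \<Longrightarrow> E n x y \<Longrightarrow> F n (f x) (f y)"
  shows "continuous_map S T f"
  unfolding continuous_map_def
proof (intro conjI allI impI)
  show "f \<in> topspace S \<rightarrow> topspace T"
    using S T f unfolding filtration_topology_def by blast
  fix U assume "openin T U"
  then have U: "\<And>x. x \<in> U \<Longrightarrow> \<exists>n. \<forall>y\<in>Y. F n x y \<longrightarrow> y \<in> U"
    using T unfolding filtration_topology_def by blast
  have "\<exists>n. \<forall>y\<in>X. E n x y \<longrightarrow> y \<in> {x \<in> X. f x \<in> U}" if x: "x \<in> X" "f x \<in> U" for x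
  proof -
    obtain n where "\<forall>y\<in>Y. F n (f x) y \<longrightarrow> y \<in> U"
      using U[OF x(2)] by blast
    with x f EF show ?thesis by blast
  qed
  then show "openin S {x \<in> topspace S. f x \<in> U}"
    using S unfolding filtration_topology_def by auto
qed

text \<open>
  The map sends a point to the one with the same code in the other space.  It preserves the relation
  of every stage in both directions, as that relation can be read off the codes.
\<close>

lemma homeomorphic_baire_filtrations:
  assumes X: "baire_filtration X E" "filtration_topology S X E"
    and Y: "baire_filtration Y F" "filtration_topology T Y F"
  shows "S homeomorphic_space T"
proof -
  interpret X: baire_filtration X E by fact
  interpret Y: baire_filtration Y F by fact
  define f where "f = inv_into Y Y.code \<circ> X.code"
  define g where "g = inv_into X X.code \<circ> Y.code"
  have f: "f x \<in> Y" "Y.code (f x) = X.code x" for x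
    using Y.bij_betw_code unfolding f_def bij_betw_def
    by (auto intro: inv_into_into f_inv_into_f)
  have g: "g y \<in> X" "X.code (g y) = Y.code y" for y
    using X.bij_betw_code unfolding g_def bij_betw_def
    by (auto intro: inv_into_into f_inv_into_f)
  have "continuous_map S T f"
    by (rule continuous_map_filtration_topology[OF X(2) Y(2)])
       (simp_all add: f X.E_iff_code_prefix Y.E_iff_code_prefix)
  moreover have "continuous_map T S g"
    by (rule continuous_map_filtration_topology[OF Y(2) X(2)])
       (simp_all add: g X.E_iff_code_prefix Y.E_iff_code_prefix)
  moreover have "\<forall>x\<in>X. g (f x) = x"
    using X.bij_betw_code f g unfolding bij_betw_def inj_on_def by metis
  moreover have "\<forall>y\<in>Y. f (g y) = y"
    using Y.bij_betw_code f g unfolding bij_betw_def inj_on_def by metis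
  moreover have "topspace S = X" "topspace T = Y"
    using X(2) Y(2) unfolding filtration_topology_def by blast+
  ultimately have "homeomorphic_maps S T f g"
    unfolding homeomorphic_maps_def by simp
  then show ?thesis
    unfolding homeomorphic_space_def by blast
qed

section \<open>Norms with values in an ordered ring\<close>

context nonarch_norm
begin

lemma norm_zero [simp]: "nrm 0 = 0"
  by (simp add: norm_eq_0_iff)

lemma norm_pos: "x \<noteq> 0 \<Longrightarrow> 0 < nrm x"
  using norm_nonneg[of x] norm_eq_0_iff[of x] by (simp add: order_less_le)

text \<open>
  The values form a ring that may have zero divisors, so cancellation rests on nonzero norms being
  units: here \<open>nrm 1\<close> is an idempotent unit.
\<close>

lemma norm_one [simp]: "nrm 1 = 1"
proof -
  obtain v where "1 = nrm 1 * v"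
    using norm_unit[of 1] by auto
  then show ?thesis
    using norm_mult[of 1 1] by (metis mult.assoc mult.right_neutral)
qed

lemma zero_less_one_value: "(0::'r) < 1"
  using norm_pos[of 1] by simp

lemma norm_power: "nrm (x ^ n) = nrm x ^ n"
  by (induction n) (simp_all add: norm_mult)

text \<open>
  Multiplication by a norm is only weakly monotone in the value ring.  Multiplying back by the norm
  of \<open>inverse z\<close> makes it strict.
\<close>

lemma norm_mult_less_cancel: "z \<noteq> 0 \<Longrightarrow> nrm (z * x) < nrm (z * y) \<longleftrightarrow> nrm x < nrm y"
proof -
  have mono: "nrm (w * x) \<le> nrm (w * y)" if "nrm x \<le> nrm y" for w x y
    using that by (simp add: norm_mult mult_left_mono norm_nonneg)
  assume "z \<noteq> 0"
  then have "inverse z * (z * x) = x" "inverse z * (z * y) = y"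
    by (simp_all add: mult.assoc[symmetric])
  then show ?thesis
    using mono[of y x z] mono[of "z * y" "z * x" "inverse z"] by (metis not_le)
qed

lemma norm_mult_le_cancel: "z \<noteq> 0 \<Longrightarrow> nrm (z * x) \<le> nrm (z * y) \<longleftrightarrow> nrm x \<le> nrm y"
  using norm_mult_less_cancel[of z y x] by (simp add: not_less[symmetric])

text \<open>
  \<open>nrm (- 1)\<close> is \<open>1\<close>, since a strict inequality either way would be reversed on multiplication by
  \<open>nrm (- 1)\<close>.
\<close>

lemma norm_uminus [simp]: "nrm (- x) = nrm x"
proof -
  have "\<not> nrm 1 < nrm (- 1)"
    using norm_mult_less_cancel[of "-1" 1 "-1"] by auto
  moreover have "\<not> nrm (- 1) < nrm 1"
    using norm_mult_less_cancel[of "-1" "-1" 1] by auto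
  ultimately have "nrm (- 1) = 1" by simp
  then show ?thesis
    using norm_mult[of "-1" x] by simp
qed

lemma norm_minus_commute: "nrm (x - y) = nrm (y - x)"
  using norm_uminus[of "x - y"] by simp

lemma norm_diff_triangle: "nrm (x - z) \<le> max (nrm (x - y)) (nrm (y - z))"
  using norm_add[of "x - y" "y - z"] by simp

lemma eventually_uniformity_norm:
  "eventually P (uniformity :: ('k \<times> 'k) filter) \<longleftrightarrow>
    (\<exists>e>0. \<forall>x y. nrm (x - y) < e \<longrightarrow> P (x, y))"
proof -
  have "eventually P (uniformity :: ('k \<times> 'k) filter) \<longleftrightarrow>
      (\<exists>e\<in>{0<..}. eventually P (principal {(x, y). nrm (x - y) < e}))"
    unfolding uniformity_norm
  proof (rule eventually_INF_base)
    show "{0::'r<..} \<noteq> {}" using zero_less_one_value by blast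
    fix a b :: 'r assume "a \<in> {0<..}" "b \<in> {0<..}"
    then show "\<exists>e\<in>{0<..}. principal {(x, y). nrm (x - y) < e} \<le>
        inf (principal {(x, y). nrm (x - y) < a}) (principal {(x, y). nrm (x - y) < b})"
      by (intro bexI[of _ "min a b"]) auto
  qed
  then show ?thesis by (auto simp: eventually_principal)
qed

lemma open_iff_norm:
  "open (U :: 'k set) \<longleftrightarrow> (\<forall>x\<in>U. \<exists>e>0. \<forall>y. nrm (x - y) < e \<longrightarrow> y \<in> U)"
  unfolding open_uniformity eventually_uniformity_norm by auto

end

section \<open>The scale of powers of a contracting scalar\<close>

text \<open>
  The powers of \<open>\<pi>\<close> give a countable scale of radii tending to \<open>0\<close>.  As each radius is the norm of a
  scalar, multiplication by \<open>\<pi>\<close> shifts the scale by one stage.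
\<close>

locale contracting_scalar = nonarch_norm nrm
  for nrm :: "'k::{field, uniform_space} \<Rightarrow>
    'r::{linordered_ring, comm_ring_1, linorder_topology, topological_semigroup_mult,
         uniform_topological_group_add, complete_uniform_space}" +
  fixes \<pi> :: 'k
  assumes pi_nonzero: "\<pi> \<noteq> 0"
    and norm_pi_less_1: "nrm \<pi> < 1"
    and norm_pi_power_tendsto_0: "(\<lambda>n. nrm \<pi> ^ n) \<longlonglongrightarrow> 0"
begin

definition near :: "nat \<Rightarrow> 'k \<Rightarrow> 'k \<Rightarrow> bool" where
  "near n a b \<longleftrightarrow> nrm (a - b) \<le> nrm (\<pi> ^ n)"

lemma norm_pi_power_pos: "0 < nrm (\<pi> ^ n)"
  using pi_nonzero by (simp add: norm_pos)

lemma norm_pi_power_less: "m < n \<Longrightarrow> nrm (\<pi> ^ n) < nrm (\<pi> ^ m)"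
proof (induction n rule: less_Suc_induct)
  case (1 i)
  then show ?case
    using norm_mult_less_cancel[of "\<pi> ^ i" \<pi> 1] norm_pi_less_1 pi_nonzero
    by (simp add: mult.commute)
qed (rule less_trans)

lemma norm_pi_power_le: "m \<le> n \<Longrightarrow> nrm (\<pi> ^ n) \<le> nrm (\<pi> ^ m)"
  using norm_pi_power_less[of m n] by (cases "m = n") auto

lemma exists_pi_power_less: "0 < e \<Longrightarrow> \<exists>n>0. nrm (\<pi> ^ n) < e"
proof -
  assume "0 < e"
  then have "eventually (\<lambda>n. nrm \<pi> ^ n < e) sequentially"
    using norm_pi_power_tendsto_0 order_tendstoD(2) by blast
  then obtain n where "nrm \<pi> ^ n < e"
    by (auto simp: eventually_sequentially)
  moreover have "nrm (\<pi> ^ Suc n) < nrm (\<pi> ^ n)" by (rule norm_pi_power_less) simp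
  ultimately show ?thesis by (metis norm_power less_trans zero_less_Suc)
qed

lemma near_refl [simp]: "near n a a"
  using norm_pi_power_pos[of n] by (simp add: near_def)

lemma near_sym: "near n a b \<Longrightarrow> near n b a"
  by (simp add: near_def norm_minus_commute)

lemma near_trans: "near n a b \<Longrightarrow> near n b c \<Longrightarrow> near n a c"
  unfolding near_def using norm_diff_triangle[of a c b] by (meson max.boundedI order_trans)

lemma near_antimono: "m \<le> n \<Longrightarrow> near n a b \<Longrightarrow> near m a b"
  unfolding near_def using norm_pi_power_le order_trans by blast

lemma near_separated: "(\<And>n. near n a b) \<Longrightarrow> a = b"
  using exists_pi_power_less[of "nrm (a - b)"] norm_pos[of "a - b"]
  unfolding near_def by (metis not_le right_minus_eq)

lemma near_mult_pi_power: "near (m + n) (\<pi> ^ m * a) (\<pi> ^ m * b) \<longleftrightarrow> near n a b"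
  unfolding near_def right_diff_distrib[symmetric] power_add
  using norm_mult_le_cancel[of "\<pi> ^ m"] pi_nonzero by simp

lemma open_iff_near: "open U \<longleftrightarrow> (\<forall>x\<in>U. \<exists>n. \<forall>y. near n x y \<longrightarrow> y \<in> U)"
  unfolding open_iff_norm near_def
  using exists_pi_power_less norm_pi_power_pos
  by (meson le_less_trans less_imp_le)

lemma open_near: "open {y. near n x y}"
  unfolding open_iff_near using near_trans by blast

lemma near_chain:
  assumes "\<And>n. N \<le> n \<Longrightarrow> near n (a n) (a (Suc n))" "N \<le> m" "m \<le> n"
  shows "near m (a m) (a n)"
  using assms(3)
proof (induction n rule: dec_induct)
  case (step n)
  then show ?case
    using assms(1)[of n] assms(2) near_antimono[of m n] near_trans by (meson le_trans)
qed simp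

text \<open>
  By the strong triangle inequality, small consecutive steps make a Cauchy sequence with no loss in
  the radii, and the limit stays near because each class is closed: the class of the limit is an
  open set which the sequence enters.
\<close>

lemma near_chain_limit:
  assumes complete: "complete (UNIV :: 'k set)"
    and a: "\<And>n. N \<le> n \<Longrightarrow> near n (a n) (a (Suc n))"
  shows "\<exists>y. \<forall>n\<ge>N. near n (a n) y"
proof -
  have "Cauchy a"
    unfolding Cauchy_uniform_iff eventually_uniformity_norm
  proof (intro allI impI)
    fix P :: "'k \<times> 'k \<Rightarrow> bool"
    assume "\<exists>e>0. \<forall>x y. nrm (x - y) < e \<longrightarrow> P (x, y)"
    then obtain e where e: "e > 0" "\<And>x y. nrm (x - y) < e \<Longrightarrow> P (x, y)" by blast
    obtain k where k: "nrm (\<pi> ^ k) < e" using exists_pi_power_less e(1) by blast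
    let ?M = "max N k"
    have near_P: "P (x, y)" if "near ?M x y" for x y
    proof (rule e(2))
      have "near k x y" using near_antimono[OF _ that] by simp
      with k show "nrm (x - y) < e" unfolding near_def by simp
    qed
    have "near ?M (a n) (a m)" if "?M \<le> n" "?M \<le> m" for n m
    proof -
      have "near ?M (a ?M) (a n)" "near ?M (a ?M) (a m)"
        using that by (auto intro!: near_chain[where N = N] a)
      then show ?thesis using near_sym near_trans by blast
    qed
    with near_P show "\<exists>M. \<forall>n\<ge>M. \<forall>m\<ge>M. P (a n, a m)" by blast
  qed
  then obtain y where y: "a \<longlonglongrightarrow> y"
    using complete cauchy_filter_complete_converges[of "filtermap a sequentially" UNIV]
    unfolding Cauchy_uniform filterlim_def by (auto simp: filtermap_bot_iff)
  have "near n (a n) y" if "N \<le> n" for n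
  proof -
    have "eventually (\<lambda>m. a m \<in> {z. near n y z}) sequentially"
      using y open_near[of n y] by (intro topological_tendstoD) auto
    then obtain m where "m \<ge> n" "near n y (a m)"
      unfolding eventually_sequentially by (metis max.cobounded1 max.cobounded2 mem_Collect_eq)
    then show ?thesis
      using near_chain[OF a that] near_sym near_trans by blast
  qed
  then show ?thesis by blast
qed

text \<open>
  Multiplication by \<open>\<pi> ^ k\<close> moves any point into a compact neighbourhood of \<open>0\<close> for large \<open>k\<close>.  A finite
  net of radius \<open>nrm (\<pi> ^ (k + n))\<close> there scales back to a net of radius \<open>nrm (\<pi> ^ n)\<close>.
\<close>

lemma countable_near_dense:
  assumes "locally_compact_space (euclidean :: 'k topology)"
  shows "\<exists>D :: 'k set. countable D \<and> (\<forall>n x. \<exists>d\<in>D. near n x d)"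
proof -
  have "\<exists>U K. openin euclidean U \<and> compactin euclidean K \<and> (0::'k) \<in> U \<and> U \<subseteq> K"
    using assms unfolding locally_compact_space_def by (rule bspec) simp
  then obtain U K :: "'k set" where U: "open U" "0 \<in> U" "U \<subseteq> K" and K: "compact K"
    by (auto simp: compactin_euclidean_iff)
  then obtain N where N: "\<And>y. near N 0 y \<Longrightarrow> y \<in> K"
    unfolding open_iff_near by blast
  have "\<exists>F. finite F \<and> K \<subseteq> (\<Union>x\<in>F. {y. near n x y})" for n
  proof -
    have "K \<subseteq> (\<Union>x\<in>K. {y. near n x y})" by auto
    then show ?thesis
      using compactE_image[OF K, of K "\<lambda>x. {y. near n x y}"] open_near by metis
  qed
  then obtain F where F: "\<And>n. finite (F n)" "\<And>n. K \<subseteq> (\<Union>x\<in>F n. {y. near n x y})"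
    by metis
  define D where "D = (\<Union>n. \<Union>k. (\<lambda>d. d / \<pi> ^ k) ` F n)"
  have "countable D"
    unfolding D_def using F(1) by (intro countable_UN countable_image) (auto intro: countable_finite)
  moreover have "\<exists>d\<in>D. near n x d" for n x
  proof -
    have "\<exists>k. near N 0 (\<pi> ^ k * x)"
    proof (cases "x = 0")
      case False
      then have "0 < nrm (\<pi> ^ N / x)" using norm_pos pi_nonzero by simp
      then obtain k where "nrm (\<pi> ^ k) < nrm (\<pi> ^ N / x)"
        using exists_pi_power_less by blast
      then have "nrm (x * \<pi> ^ k) < nrm (x * (\<pi> ^ N / x))"
        using norm_mult_less_cancel False by blast
      then have "near N 0 (\<pi> ^ k * x)"
        using False by (simp add: near_def mult.commute)
      then show ?thesis by blast
    qed simp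
    then obtain k where "\<pi> ^ k * x \<in> K" using N by blast
    then obtain d where d: "d \<in> F (k + n)" "near (k + n) d (\<pi> ^ k * x)"
      using F(2) by blast
    have "d = \<pi> ^ k * (d / \<pi> ^ k)" using pi_nonzero by simp
    with d(2) have "near n (d / \<pi> ^ k) x"
      using near_mult_pi_power by metis
    moreover have "d / \<pi> ^ k \<in> D" using d(1) unfolding D_def by blast
    ultimately show ?thesis using near_sym by blast
  qed
  ultimately show ?thesis by blast
qed

text \<open>
  Finitely supported sequences, given by lists padded with zeros, are dense in both spaces.  With
  entries from a countable set they are countable.
\<close>

definition list_seq :: "'k list \<Rightarrow> nat \<Rightarrow> 'k" where
  "list_seq xs j = (if j < length xs then xs ! j else 0)"

lemma list_seq_in_c0: "list_seq xs \<in> c0 nrm"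
proof -
  have "{j. e < nrm (list_seq xs j)} \<subseteq> {..<length xs}" if "0 < e" for e
    using that unfolding list_seq_def by (auto split: if_splits)
  then show ?thesis
    unfolding c0_def using finite_subset by blast
qed

lemma list_seq_approx:
  assumes "\<forall>n x. \<exists>d\<in>D. near n x d"
  shows "\<exists>xs\<in>lists D. \<forall>j. (j < m \<longrightarrow> near n (x j) (list_seq xs j)) \<and>
    (m \<le> j \<longrightarrow> list_seq xs j = 0)"
proof -
  have "\<forall>j. \<exists>d. d \<in> D \<and> near n (x j) d"
    using assms by blast
  then obtain d where d: "\<And>j. d j \<in> D" "\<And>j. near n (x j) (d j)"
    by metis
  then have "map d [0..<m] \<in> lists D" by auto
  moreover have "list_seq (map d [0..<m]) j = (if j < m then d j else 0)" for j
    by (simp add: list_seq_def)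
  ultimately show ?thesis using d by (intro bexI) auto
qed

section \<open>The two filtrations\<close>

text \<open>
  Stage \<open>0\<close> of \<open>c0_near\<close> is made the total relation so that the tree has a single root.  For
  \<open>prod_near\<close> this is automatic, since stage \<open>0\<close> constrains no coordinate.
\<close>

definition c0_near :: "nat \<Rightarrow> (nat \<Rightarrow> 'k) \<Rightarrow> (nat \<Rightarrow> 'k) \<Rightarrow> bool" where
  "c0_near n x y \<longleftrightarrow> n = 0 \<or> (\<forall>j. near n (x j) (y j))"

definition prod_near :: "nat \<Rightarrow> (nat \<Rightarrow> 'k) \<Rightarrow> (nat \<Rightarrow> 'k) \<Rightarrow> bool" where
  "prod_near n x y \<longleftrightarrow> (\<forall>j<n. near n (x j) (y j))"

lemma c0_cofinite_small:
  assumes "x \<in> c0 nrm" "0 < e"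
  obtains m where "\<And>j. m \<le> j \<Longrightarrow> nrm (x j) \<le> e"
proof -
  have "finite {j. e < nrm (x j)}" using assms by (simp add: c0_def)
  then obtain m where "\<And>j. e < nrm (x j) \<Longrightarrow> j < m"
    using finite_nat_set_iff_bounded by auto
  then show thesis using that by (meson not_le)
qed

lemma c0I:
  assumes "\<And>e. 0 < e \<Longrightarrow> \<exists>m. \<forall>j\<ge>m. nrm (x j) \<le> e"
  shows "x \<in> c0 nrm"
  unfolding c0_def
proof (intro CollectI allI impI)
  fix e :: 'r assume "0 < e"
  then obtain m where "\<forall>j\<ge>m. nrm (x j) \<le> e" using assms by blast
  then have "{j. e < nrm (x j)} \<subseteq> {..<m}" by (auto simp: not_less[symmetric])
  then show "finite {j. e < nrm (x j)}" using finite_subset by blast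
qed

text \<open>\<open>c\<^sub>0\<close> is closed under uniform limits, which gives its completeness.\<close>

lemma c0_near_closed:
  assumes y: "\<And>n. 0 < n \<Longrightarrow> \<exists>x\<in>c0 nrm. c0_near n x y"
  shows "y \<in> c0 nrm"
proof (rule c0I)
  fix e :: 'r assume "0 < e"
  then obtain n where n: "n > 0" "nrm (\<pi> ^ n) < e" using exists_pi_power_less by blast
  obtain x where x: "x \<in> c0 nrm" "c0_near n x y" using y n(1) by blast
  obtain m where m: "\<And>j. m \<le> j \<Longrightarrow> nrm (x j) \<le> e" using c0_cofinite_small x(1) \<open>0 < e\<close> by blast
  have "nrm (y j) \<le> e" if "m \<le> j" for j
  proof -
    have "nrm (y j - x j) \<le> nrm (\<pi> ^ n)"
      using x(2) n(1) by (simp add: c0_near_def near_def norm_minus_commute)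
    then show ?thesis
      using norm_add[of "y j - x j" "x j"] n(2) m[OF that] by (auto simp: le_max_iff_disj)
  qed
  then show "\<exists>m. \<forall>j\<ge>m. nrm (y j) \<le> e" by blast
qed

lemma c0_diff: "x \<in> c0 nrm \<Longrightarrow> y \<in> c0 nrm \<Longrightarrow> (\<lambda>j. x j - y j) \<in> c0 nrm"
proof (rule c0I)
  fix e :: 'r assume x: "x \<in> c0 nrm" and y: "y \<in> c0 nrm" and e: "0 < e"
  obtain m where m: "\<And>j. m \<le> j \<Longrightarrow> nrm (x j) \<le> e" using c0_cofinite_small x e by blast
  obtain l where l: "\<And>j. l \<le> j \<Longrightarrow> nrm (y j) \<le> e" using c0_cofinite_small y e by blast
  have "nrm (x j - y j) \<le> e" if "max m l \<le> j" for j
    using norm_diff_triangle[of "x j" "y j" 0] m[of j] l[of j] that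
    by (auto simp: le_max_iff_disj)
  then show "\<exists>m. \<forall>j\<ge>m. nrm (x j - y j) \<le> e" by blast
qed

lemma c0_fun_upd: "x \<in> c0 nrm \<Longrightarrow> x(i := a) \<in> c0 nrm"
proof (rule c0I)
  fix e :: 'r assume x: "x \<in> c0 nrm" and e: "0 < e"
  obtain m where m: "\<And>j. m \<le> j \<Longrightarrow> nrm (x j) \<le> e" using c0_cofinite_small x e by blast
  then have "nrm ((x(i := a)) j) \<le> e" if "max m (Suc i) \<le> j" for j
    using that by auto
  then show "\<exists>m. \<forall>j\<ge>m. nrm ((x(i := a)) j) \<le> e" by blast
qed

text \<open>
  Limits are taken coordinatewise; the nearness bounds are uniform in the coordinate, so the limit
  lies in \<open>c\<^sub>0\<close>.  For branching, adding \<open>\<pi> ^ n\<close> in the single coordinate \<open>m\<close> stays in the class at stage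
  \<open>n\<close>, and different choices of \<open>m\<close> are separated at stage \<open>Suc n\<close>.
\<close>

lemma baire_filtration_c0:
  assumes complete: "complete (UNIV :: 'k set)"
    and D: "countable D" "\<forall>n x. \<exists>d\<in>D. near n x d"
  shows "baire_filtration (c0 nrm) c0_near"
proof
  show "equivp (c0_near n)" for n
    by (rule equivpI; intro reflpI sympI transpI)
       (auto simp: c0_near_def intro: near_sym near_trans)
  show "c0_near 0 x y" for x y by (simp add: c0_near_def)
  show "c0_near (Suc n) x y \<Longrightarrow> c0_near n x y" for n x y
    by (auto simp: c0_near_def intro: near_antimono[of n "Suc n"])
  show "x = y" if "\<And>n. c0_near n x y" for x y
  proof
    fix j
    have "near (Suc n) (x j) (y j)" for n using that[of "Suc n"] by (simp add: c0_near_def)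
    then show "x j = y j" using near_antimono near_separated by (meson le_SucI order_refl)
  qed
  show "c0 nrm \<noteq> {}" using list_seq_in_c0 by blast
  show "\<exists>y\<in>c0 nrm. \<forall>n. c0_near n (s n) y"
    if s: "\<And>n. s n \<in> c0 nrm" "\<And>n. c0_near n (s n) (s (Suc n))" for s
  proof -
    \<comment> \<open>Stage \<open>0\<close> carries no information, so the coordinate chains start at \<open>1\<close>.\<close>
    have "\<exists>z. \<forall>n\<ge>1. near n (s n j) z" for j
      using s(2) by (intro near_chain_limit complete) (metis c0_near_def not_one_le_zero)
    then obtain y where y: "\<And>j n. 1 \<le> n \<Longrightarrow> near n (s n j) (y j)" by metis
    then have near: "c0_near n (s n) y" for n by (cases n) (auto simp: c0_near_def)
    with s(1) have "y \<in> c0 nrm" using c0_near_closed by blast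
    with near show ?thesis by blast
  qed
  show "\<exists>S\<subseteq>c0 nrm. countable S \<and> (\<forall>n. \<forall>x\<in>c0 nrm. \<exists>d\<in>S. c0_near n x d)"
  proof (intro exI[of _ "list_seq ` lists D"] conjI allI ballI)
    show "list_seq ` lists D \<subseteq> c0 nrm" using list_seq_in_c0 by blast
    show "countable (list_seq ` lists D)" using D(1) by simp
    fix n x assume "x \<in> c0 nrm"
    then obtain m where m: "\<And>j. m \<le> j \<Longrightarrow> nrm (x j) \<le> nrm (\<pi> ^ n)"
      using c0_cofinite_small norm_pi_power_pos by blast
    obtain xs where "xs \<in> lists D" "\<And>j. j < m \<Longrightarrow> near n (x j) (list_seq xs j)"
        "\<And>j. m \<le> j \<Longrightarrow> list_seq xs j = 0"
      using list_seq_approx[OF D(2), of m n x] by blast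
    moreover from this m have "near n (x j) (list_seq xs j)" for j
      by (cases "j < m") (auto simp: near_def)
    ultimately show "\<exists>d\<in>list_seq ` lists D. c0_near n x d"
      unfolding c0_near_def by blast
  qed
  show "\<exists>t :: nat \<Rightarrow> _. \<forall>m. t m \<in> c0 nrm \<and> c0_near n x (t m) \<and>
      (\<forall>l. l \<noteq> m \<longrightarrow> \<not> c0_near (Suc n) (t m) (t l))" if x: "x \<in> c0 nrm" for x n
  proof (intro exI[of _ "\<lambda>m. x(m := x m + \<pi> ^ n)"] allI conjI impI)
    fix m
    show "x(m := x m + \<pi> ^ n) \<in> c0 nrm" using x by (rule c0_fun_upd)
    show "c0_near n x (x(m := x m + \<pi> ^ n))"
      unfolding c0_near_def by (auto simp: near_def less_imp_le norm_pi_power_pos)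
    fix l assume "l \<noteq> m"
    then have "\<not> near (Suc n) ((x(m := x m + \<pi> ^ n)) m) ((x(l := x l + \<pi> ^ n)) m)"
      using norm_pi_power_less[of n "Suc n"] by (simp add: near_def)
    then show "\<not> c0_near (Suc n) (x(m := x m + \<pi> ^ n)) (x(l := x l + \<pi> ^ n))"
      unfolding c0_near_def by blast
  qed
qed

text \<open>
  The supremum defining the norm of a difference is attained, so balls in \<open>c\<^sub>0\<close> and uniform nearness of
  coordinates can be compared directly.
\<close>

lemma filtration_topology_c0: "filtration_topology (c0_topology nrm) (c0 nrm) c0_near"
proof -
  have "(\<exists>e>0. \<forall>y\<in>c0 nrm. c0_norm nrm (\<lambda>j. y j - x j) < e \<longrightarrow> y \<in> U) \<longleftrightarrow>
      (\<exists>n. \<forall>y\<in>c0 nrm. c0_near n x y \<longrightarrow> y \<in> U)" (is "?L \<longleftrightarrow> ?R") if x: "x \<in> c0 nrm" for x U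
  proof
    assume ?L
    then obtain e where e: "e > 0"
      "\<And>y. y \<in> c0 nrm \<Longrightarrow> c0_norm nrm (\<lambda>j. y j - x j) < e \<Longrightarrow> y \<in> U" by blast
    obtain n where n: "n > 0" "nrm (\<pi> ^ n) < e" using exists_pi_power_less e(1) by blast
    have "y \<in> U" if y: "y \<in> c0 nrm" "c0_near n x y" for y
    proof (rule e(2)[OF y(1)])
      obtain j where "c0_norm nrm (\<lambda>j. y j - x j) = nrm (y j - x j)"
        using c0_norm_attained[OF c0_diff[OF y(1) x]] by blast
      also have "\<dots> \<le> nrm (\<pi> ^ n)"
        using y(2) n(1) by (simp add: c0_near_def near_def norm_minus_commute)
      finally show "c0_norm nrm (\<lambda>j. y j - x j) < e" using n(2) by simp
    qed
    then show ?R by blast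
  next
    assume ?R
    then obtain n where n: "\<And>y. y \<in> c0 nrm \<Longrightarrow> c0_near n x y \<Longrightarrow> y \<in> U" by blast
    have "y \<in> U" if y: "y \<in> c0 nrm" "c0_norm nrm (\<lambda>j. y j - x j) < nrm (\<pi> ^ n)" for y
    proof (rule n[OF y(1)])
      have "nrm (y j - x j) \<le> c0_norm nrm (\<lambda>j. y j - x j)" for j
        using c0_norm_attained[OF c0_diff[OF y(1) x]] by metis
      with y(2) show "c0_near n x y"
        unfolding c0_near_def near_def
        by (metis le_less_trans less_imp_le norm_minus_commute)
    qed
    then show ?L using norm_pi_power_pos by blast
  qed
  then show ?thesis
    unfolding filtration_topology_def openin_c0_topology topspace_c0_topology by blast
qed

text \<open>
  Branching uses that the field is unbounded.  Coordinate \<open>n\<close> is unconstrained at stage \<open>n\<close> but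
  constrained at stage \<open>Suc n\<close>, and the scalars \<open>1 / \<pi> ^ Suc m\<close> have pairwise different norms above
  \<open>1\<close>, so any two are at distance above \<open>1\<close>.
\<close>

lemma baire_filtration_product:
  assumes complete: "complete (UNIV :: 'k set)"
    and D: "countable D" "\<forall>n x. \<exists>d\<in>D. near n x d"
  shows "baire_filtration UNIV prod_near"
proof
  show "equivp (prod_near n)" for n
    by (rule equivpI; intro reflpI sympI transpI)
       (auto simp: prod_near_def intro: near_sym near_trans)
  show "prod_near 0 x y" for x y by (simp add: prod_near_def)
  show "prod_near (Suc n) x y \<Longrightarrow> prod_near n x y" for n x y
    by (auto simp: prod_near_def intro: near_antimono[of n "Suc n"])
  show "x = y" if "\<And>n. prod_near n x y" for x y
  proof
    fix j
    have "near n (x j) (y j)" for n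
      using that[of "max n (Suc j)"] near_antimono[of n "max n (Suc j)"]
      by (simp add: prod_near_def)
    then show "x j = y j" by (rule near_separated)
  qed
  show "(UNIV :: (nat \<Rightarrow> 'k) set) \<noteq> {}" by simp
  show "\<exists>y\<in>UNIV. \<forall>n. prod_near n (s n) y"
    if s: "\<And>n. prod_near n (s n) (s (Suc n))" for s
  proof -
    \<comment> \<open>Stage \<open>n\<close> sees only coordinates below \<open>n\<close>, so the chain in coordinate \<open>j\<close> starts at \<open>Suc j\<close>.\<close>
    have "\<exists>z. \<forall>n\<ge>Suc j. near n (s n j) z" for j
      using s by (intro near_chain_limit complete) (auto simp: prod_near_def)
    then obtain y where "\<And>j n. Suc j \<le> n \<Longrightarrow> near n (s n j) (y j)" by metis
    then show ?thesis unfolding prod_near_def by (meson Suc_leI UNIV_I)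
  qed
  show "\<exists>S\<subseteq>UNIV. countable S \<and> (\<forall>n. \<forall>x\<in>UNIV. \<exists>d\<in>S. prod_near n x d)"
  proof (intro exI[of _ "list_seq ` lists D"] conjI allI ballI)
    show "countable (list_seq ` lists D)" using D(1) by simp
    fix n x
    show "\<exists>d\<in>list_seq ` lists D. prod_near n x d"
      using list_seq_approx[OF D(2), of n n x] unfolding prod_near_def by blast
  qed simp
  show "\<exists>t :: nat \<Rightarrow> _. \<forall>m. t m \<in> UNIV \<and> prod_near n x (t m) \<and>
      (\<forall>l. l \<noteq> m \<longrightarrow> \<not> prod_near (Suc n) (t m) (t l))" for x n
  proof (intro exI[of _ "\<lambda>m. x(n := 1 / \<pi> ^ Suc m)"] allI conjI impI)
    fix m
    show "prod_near n x (x(n := 1 / \<pi> ^ Suc m))" by (simp add: prod_near_def)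
    have far: "\<not> near (Suc n) (1 / \<pi> ^ Suc m) (1 / \<pi> ^ Suc l)" if "l < m" for l m
    proof
      let ?a = "1 / \<pi> ^ Suc m" and ?b = "1 / \<pi> ^ Suc l"
      have "?b = \<pi> ^ (m - l) * ?a"
        using pi_nonzero that by (simp add: power_diff)
      then have ba: "nrm ?b < nrm ?a"
        using norm_mult_less_cancel[of ?a "\<pi> ^ (m - l)" 1] norm_pi_power_less[of 0 "m - l"]
          pi_nonzero that by (simp add: mult.commute)
      have "nrm (\<pi> ^ Suc n) < nrm 1" using norm_pi_power_less[of 0 "Suc n"] by simp
      also have "nrm 1 < nrm ?a"
        using norm_mult_less_cancel[of ?a "\<pi> ^ Suc m" 1] norm_pi_power_less[of 0 "Suc m"]
          pi_nonzero by simp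
      finally have "nrm (\<pi> ^ Suc n) < nrm ?a" .
      moreover assume "near (Suc n) ?a ?b"
      ultimately have "nrm (?a - ?b) < nrm ?a" unfolding near_def by (rule le_less_trans[rotated])
      with ba show False
        using norm_add[of "?a - ?b" ?b] by (auto simp: le_max_iff_disj)
    qed
    fix l assume "l \<noteq> m"
    then have "\<not> near (Suc n) (1 / \<pi> ^ Suc m) (1 / \<pi> ^ Suc l)"
      using far[of l m] far[of m l] near_sym by (metis nat_neq_iff)
    then show "\<not> prod_near (Suc n) (x(n := 1 / \<pi> ^ Suc m)) (x(n := 1 / \<pi> ^ Suc l))"
      unfolding prod_near_def by auto
  qed simp
qed

text \<open>
  A basic open set of the product constrains finitely many coordinates, each by some stage; one \<open>n\<close>
  beyond all these coordinates and stages serves for both constraints.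
\<close>

lemma filtration_topology_product:
  "filtration_topology (product_topology (\<lambda>_::nat. (euclidean :: 'k topology)) UNIV) UNIV prod_near"
  unfolding filtration_topology_def
proof (intro conjI allI)
  let ?T = "product_topology (\<lambda>_::nat. (euclidean :: 'k topology)) UNIV"
  show "topspace ?T = UNIV" by simp
  fix U
  show "openin ?T U \<longleftrightarrow> U \<subseteq> UNIV \<and> (\<forall>x\<in>U. \<exists>n. \<forall>y\<in>UNIV. prod_near n x y \<longrightarrow> y \<in> U)"
  proof
    assume U: "openin ?T U"
    have "\<exists>n. \<forall>y. prod_near n x y \<longrightarrow> y \<in> U" if x: "x \<in> U" for x
    proof -
      obtain V where V: "\<And>j. x j \<in> V j" "\<And>j. open (V j)" "finite {j. V j \<noteq> UNIV}"
          "\<And>y. (\<And>j. y j \<in> V j) \<Longrightarrow> y \<in> U"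
      proof -
        from product_topology_open_contains_basis[OF U x]
        obtain V where V: "x \<in> (\<Pi>\<^sub>E j\<in>UNIV. V j)" "\<forall>j. openin euclidean (V j)"
            "finite {j. V j \<noteq> topspace euclidean}" "(\<Pi>\<^sub>E j\<in>UNIV. V j) \<subseteq> U"
          by blast
        show thesis
        proof (rule that[of V])
          show "x j \<in> V j" for j using PiE_mem[OF V(1)] by simp
          show "y \<in> U" if "\<And>j. y j \<in> V j" for y using V(4) that by blast
        qed (use V in simp_all)
      qed
      have "\<forall>j. \<exists>k. \<forall>y. near k (x j) y \<longrightarrow> y \<in> V j"
        using V(1,2) unfolding open_iff_near by blast
      then obtain k where k: "\<And>j y. near (k j) (x j) y \<Longrightarrow> y \<in> V j"
        by metis
      obtain n where n: "\<And>j. V j \<noteq> UNIV \<Longrightarrow> k j \<le> n \<and> j < n"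
      proof -
        have "finite ((\<lambda>j. max (k j) (Suc j)) ` {j. V j \<noteq> UNIV})" using V(3) by simp
        then obtain n where "\<And>i. i \<in> (\<lambda>j. max (k j) (Suc j)) ` {j. V j \<noteq> UNIV} \<Longrightarrow> i \<le> n"
          using finite_nat_set_iff_bounded_le by metis
        then show thesis using that[of n] by force
      qed
      have "y \<in> U" if "prod_near n x y" for y
      proof (rule V(4))
        fix j show "y j \<in> V j"
          using n[of j] k[of j] that near_antimono[of "k j" n] unfolding prod_near_def by blast
      qed
      then show ?thesis by blast
    qed
    then show "U \<subseteq> UNIV \<and> (\<forall>x\<in>U. \<exists>n. \<forall>y\<in>UNIV. prod_near n x y \<longrightarrow> y \<in> U)" by blast
  next
    assume R: "U \<subseteq> UNIV \<and> (\<forall>x\<in>U. \<exists>n. \<forall>y\<in>UNIV. prod_near n x y \<longrightarrow> y \<in> U)"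
    show "openin ?T U"
    proof (subst openin_subopen, intro ballI)
      fix x assume "x \<in> U"
      then obtain n where n: "\<And>y. prod_near n x y \<Longrightarrow> y \<in> U" using R by blast
      let ?V = "\<lambda>j. if j < n then {z. near n (x j) z} else UNIV"
      have "openin ?T (\<Pi>\<^sub>E j\<in>UNIV. ?V j)"
      proof (rule product_topology_basis)
        show "openin euclidean (?V j)" for j using open_near by simp
        show "finite {j. ?V j \<noteq> topspace euclidean}"
          by (rule finite_subset[of _ "{..<n}"]) auto
      qed
      moreover have "x \<in> (\<Pi>\<^sub>E j\<in>UNIV. ?V j)" by auto
      moreover have "(\<Pi>\<^sub>E j\<in>UNIV. ?V j) \<subseteq> U"
      proof
        fix y assume y: "y \<in> (\<Pi>\<^sub>E j\<in>UNIV. ?V j)"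
        have "near n (x j) (y j)" if "j < n" for j
          using PiE_mem[OF y, of j] that by simp
        then show "y \<in> U" using n by (simp add: prod_near_def)
      qed
      ultimately show "\<exists>W. openin ?T W \<and> x \<in> W \<and> W \<subseteq> U" by blast
    qed
  qed
qed

end

section \<open>The homeomorphism\<close>

theorem theorem2:
  fixes nrm :: "'k::{field, uniform_space} \<Rightarrow>
    'r::{linordered_ring, comm_ring_1, linorder_topology, topological_semigroup_mult,
         uniform_topological_group_add, complete_uniform_space}"
  assumes "nonarch_norm nrm"
    and "\<And>p q :: 'r. 1 < p \<Longrightarrow> p * q = 1 \<Longrightarrow> (\<lambda>n. q ^ n) \<longlonglongrightarrow> 0"
    and "infinite (UNIV :: 'k set)"
    and "infinite (value_group nrm)"
    and "0 \<in> closure (value_group nrm)"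
    and "\<exists>x. nrm x > 1"
    and "complete (UNIV :: 'k set)"
    and "locally_compact_space (euclidean :: 'k topology)"
    and "discrete (value_group nrm)"
  shows "c0_topology nrm homeomorphic_space product_topology (\<lambda>_::nat. (euclidean :: 'k topology)) UNIV"
proof -
  interpret nonarch_norm nrm by fact
  obtain z where z: "nrm z > 1" using assms(6) by blast
  then have z0: "z \<noteq> 0" using zero_less_one_value by auto
  have inv: "nrm z * nrm (1 / z) = 1"
    using z0 by (simp flip: norm_mult)
  interpret contracting_scalar nrm "1 / z"
  proof
    show "1 / z \<noteq> 0" using z0 by simp
    show "nrm (1 / z) < 1"
      using norm_mult_less_cancel[of z "1 / z" 1] z z0 by simp
    show "(\<lambda>n. nrm (1 / z) ^ n) \<longlonglongrightarrow> 0" using assms(2)[OF z inv] .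
  qed
  obtain D where D: "countable D" "\<forall>n x. \<exists>d\<in>D. near n x d"
    using countable_near_dense[OF assms(8)] by blast
  show ?thesis
    using homeomorphic_baire_filtrations
      baire_filtration_c0[OF assms(7) D] filtration_topology_c0
      baire_filtration_product[OF assms(7) D] filtration_topology_product by blast
qed

end
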